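(* Let $\mathscr G_1=\{f\in\mathcal F:(f,f)\le1\}$ be the set of admissible $L\varphi$, let the noise range over $\{\eta:M(\eta,\eta)\le1\}$, and suppose that 1) $R(L)$ and $H(N(L))$ are closed sets; 2) $R(T)=\{[Lx,Hx]:x\in\mathscr D(L)\}$ is a closed set in $\mathcal F\times\mathcal Y$. Then for, and only for, $\ell\in R(L^* )+R(H^* )$ the unique minimax estimation $\hat u$ is given by $\hat u=H\hat p$, where $\hat p$ is any solution (with $\hat p\in\mathscr D(L)$, $\hat z\in\mathscr D(L^* )$) of the equations $$L^*\hat z=\ell-H^*H\hat p,\qquad L\hat p=\hat z.$$ The minimax error is $$\hat\sigma(\ell)=(\ell,\hat p)^{1/2}.$$
   Context: $\mathcal H,\mathcal F,\mathcal Y$ are (real) Hilbert spaces, with inner products denoted $(\cdot,\cdot)$. $L:\mathcal H\to\mathcal F$ is a closed linear operator whose domain $\mathscr D(L)$ is dense in $\mathcal H$; $H\in\mathscr L(\mathcal H,\mathcal Y)$ is a bounded linear operator. $N(L)$ is the kernel of $L$, $R(\cdot)$ denotes the range. One observes $y=H\varphi+\eta$, where $\varphi\in\mathscr D(L)$ is unknown with $L\varphi\in\mathscr G_1$ and $\eta$ is a random $\mathcal Y$-valued vector with zero mean; $M$ denotes mathematical expectation. For $\ell\in\mathcal H$ the quantity $(\ell,\varphi)$ is estimated by $(u,y)+c$, $u\in\mathcal Y$, $c\in\mathbb R$. Put $J(u,c)=\sup_{\varphi,\eta}M((\ell,\varphi)-(u,y)-c)^2$, the supremum being over all $\varphi\in\mathscr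 D(L)$ with $L\varphi\in\mathscr G_1$ and all admissible $\eta$. The minimax error is $\hat\sigma(\ell)=(\inf_{u,c}J(u,c))^{1/2}$. The minimax estimation is $(\hat u,\cdot)+\hat c$ with $J(\hat u,\hat c)=\inf_{u,c}J(u,c)$ (meaningful when this infimum is finite); it is identified with the vector $\hat u$. *)

theory Defs
  imports "HOL-Probability.Probability"
begin

text \<open>
  Hilbert spaces are types of sort \<open>{real_inner, complete_space}\<close>.  An unbounded operator is
  given by its domain \<open>D\<close> together with a total function \<open>L\<close>, whose values outside \<open>D\<close> are
  irrelevant.
\<close>

definition linear_operator_on :: "'h::real_vector set \<Rightarrow> ('h \<Rightarrow> 'f::real_vector) \<Rightarrow> bool" where
  "linear_operator_on D L \<longleftrightarrow> subspace D \<and>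
     (\<forall>x\<in>D. \<forall>y\<in>D. L (x + y) = L x + L y) \<and>
     (\<forall>r. \<forall>x\<in>D. L (r *\<^sub>R x) = r *\<^sub>R L x)"

definition closed_densely_defined ::
  "'h::real_normed_vector set \<Rightarrow> ('h \<Rightarrow> 'f::real_normed_vector) \<Rightarrow> bool" where
  "closed_densely_defined D L \<longleftrightarrow>
     linear_operator_on D L \<and> closed {(x, L x) | x. x \<in> D} \<and> closure D = UNIV"

definition kernel_on :: "'h set \<Rightarrow> ('h \<Rightarrow> 'f::zero) \<Rightarrow> 'h set" where
  "kernel_on D L = {x \<in> D. L x = 0}"

definition adjoint_domain :: "'h::real_inner set \<Rightarrow> ('h \<Rightarrow> 'f::real_inner) \<Rightarrow> 'f set" where
  "adjoint_domain D L = {z. \<exists>w. \<forall>x\<in>D. L x \<bullet> z = x \<bullet> w}"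

text \<open>The vector below is unique for \<open>z\<close> in \<^term>\<open>adjoint_domain D L\<close> whenever \<open>D\<close> is dense.\<close>

definition adjoint_on :: "'h::real_inner set \<Rightarrow> ('h \<Rightarrow> 'f::real_inner) \<Rightarrow> 'f \<Rightarrow> 'h" where
  "adjoint_on D L z = (THE w. \<forall>x\<in>D. L x \<bullet> z = x \<bullet> w)"

text \<open>
  \<open>\<eta>\<close> is a random vector on the probability space \<open>P\<close>.  The zero mean is taken in the weak sense,
  so that the space of values need not be separable; for separable spaces and finite second
  moment this is the vanishing of the Bochner integral of \<open>\<eta>\<close>.
\<close>

definition zero_mean_random_vector :: "'w measure \<Rightarrow> ('w \<Rightarrow> 'y::real_inner) \<Rightarrow> bool" where
  "zero_mean_random_vector P \<eta> \<longleftrightarrow> prob_space P \<and> \<eta> \<in> borel_measurable P \<and>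
     (\<forall>v. has_bochner_integral P (\<lambda>w. v \<bullet> \<eta> w) 0)"

text \<open>
  The noise ranges over random vectors on arbitrary probability spaces.  Only the distribution
  of \<open>\<eta>\<close> matters in what follows, and every Borel distribution on \<open>'y\<close> is realised by the
  identity on a probability space with sample points in \<open>'y\<close>; so it suffices to let \<open>P\<close> range
  over measures on \<open>'y\<close>.
\<close>

type_synonym 'y noise = "'y measure \<times> ('y \<Rightarrow> 'y)"

definition bounded_variance_noise :: "'y::real_inner noise set" where
  "bounded_variance_noise = {(P, \<eta>). zero_mean_random_vector P \<eta> \<and>
     (\<integral>\<^sup>+ w. ennreal (\<eta> w \<bullet> \<eta> w) \<partial>P) \<le> 1}"

text \<open>
  \<open>G\<close> is the set of admissible values of \<open>L \<phi>\<close> and \<open>N\<close> the set of admissible noises; the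
  observation is \<open>H \<phi> + \<eta>\<close>.
\<close>

definition risk ::
  "'h::real_inner set \<Rightarrow> ('h \<Rightarrow> 'f) \<Rightarrow> ('h \<Rightarrow> 'y::real_inner) \<Rightarrow> 'f set \<Rightarrow> 'y noise set \<Rightarrow>
     'h \<Rightarrow> 'y \<Rightarrow> real \<Rightarrow> ennreal" where
  "risk D L H G N l u c =
     (SUP \<phi>\<in>{\<phi>\<in>D. L \<phi> \<in> G}. SUP (P, \<eta>)\<in>N.
        \<integral>\<^sup>+ w. ennreal ((l \<bullet> \<phi> - u \<bullet> (H \<phi> + \<eta> w) - c)\<^sup>2) \<partial>P)"

definition minimax_risk ::
  "'h::real_inner set \<Rightarrow> ('h \<Rightarrow> 'f) \<Rightarrow> ('h \<Rightarrow> 'y::real_inner) \<Rightarrow> 'f set \<Rightarrow> 'y noise set \<Rightarrow>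
     'h \<Rightarrow> ennreal" where
  "minimax_risk D L H G N l = (INF u. INF c. risk D L H G N l u c)"

definition minimax_error ::
  "'h::real_inner set \<Rightarrow> ('h \<Rightarrow> 'f) \<Rightarrow> ('h \<Rightarrow> 'y::real_inner) \<Rightarrow> 'f set \<Rightarrow> 'y noise set \<Rightarrow>
     'h \<Rightarrow> ereal" where
  "minimax_error D L H G N l =
     (if minimax_risk D L H G N l = \<infinity> then \<infinity>
      else ereal (sqrt (enn2real (minimax_risk D L H G N l))))"

text \<open>
  An estimate \<open>(u, \<cdot>) + c\<close> is identified with \<open>u\<close>.  Without the finiteness condition every \<open>u\<close>
  would count as minimax when the risk is infinite everywhere.
\<close>

definition minimax_estimation ::
  "'h::real_inner set \<Rightarrow> ('h \<Rightarrow> 'f) \<Rightarrow> ('h \<Rightarrow> 'y::real_inner) \<Rightarrow> 'f set \<Rightarrow> 'y noise set \<Rightarrow>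
     'h \<Rightarrow> 'y \<Rightarrow> bool" where
  "minimax_estimation D L H G N l u \<longleftrightarrow> minimax_risk D L H G N l < \<infinity> \<and>
     (\<exists>c. risk D L H G N l u c = minimax_risk D L H G N l)"

text \<open>For bounded \<open>H\<close> between Hilbert spaces, \<^const>\<open>adjoint\<close> is the Hilbert space adjoint.\<close>

definition estimable ::
  "'h::real_inner set \<Rightarrow> ('h \<Rightarrow> 'f::real_inner) \<Rightarrow> ('h \<Rightarrow> 'y::real_inner) \<Rightarrow> 'h set" where
  "estimable D L H =
     {a + b | a b. a \<in> adjoint_on D L ` adjoint_domain D L \<and> b \<in> range (adjoint H)}"

definition normal_equations ::
  "'h::real_inner set \<Rightarrow> ('h \<Rightarrow> 'f::real_inner) \<Rightarrow> ('h \<Rightarrow> 'y::real_inner) \<Rightarrow> 'h \<Rightarrow>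
     'h \<Rightarrow> 'f \<Rightarrow> bool" where
  "normal_equations D L H l p z \<longleftrightarrow> p \<in> D \<and> z \<in> adjoint_domain D L \<and>
     adjoint_on D L z = l - adjoint H (H p) \<and> L p = z"

end

theory Submission imports Defs begin

text \<open>
  For an estimate $(u, \cdot) + c$ the noise contributes $|u|^2$ to the risk, attained by the
  two-point noise $\pm u/|u|$, and the signal contributes the supremum of
  $((\ell, x) - (u, H x) - c)^2$ over $|L x| \le 1$.  If $p$ satisfies
  $L^* L p + H^* H p = \ell$, testing with multiples of $p$ shows that the risk at $(u, c)$ is at
  least $(\ell, p) + |H p - u|^2$, while the risk at $(H p, 0)$ is at most $(\ell, p)$.  Such a $p$
  exists for estimable $\ell$: if $\ell = L^* z + H^* u$, then $(L p, H p)$ is the orthogonal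
  projection of $(z, u)$ onto the closed range of $T$.  Conversely, a finite risk bounds
  $(\ell, x) - (u, H x)$ by a multiple of $|L x|$, and Riesz representation on $R(L)$ puts
  $\ell - H^* u$ into $R(L^*)$.
\<close>

section \<open>Riesz representation and adjoints\<close>

text \<open>The representing vector minimises \<open>s \<bullet> s - 2 * f s\<close> over \<open>S\<close>; orthogonal projection of \<open>w\<close>
  is the case \<open>f s = s \<bullet> w\<close>.\<close>

lemma riesz_on_closed_subspace:
  fixes S :: "'a::{real_inner, complete_space} set" and f :: "'a \<Rightarrow> real"
  assumes S: "subspace S" and "closed S"
    and add: "\<And>s t. s \<in> S \<Longrightarrow> t \<in> S \<Longrightarrow> f (s + t) = f s + f t"
    and scale: "\<And>r s. s \<in> S \<Longrightarrow> f (r *\<^sub>R s) = r * f s"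
    and bound: "\<And>s. s \<in> S \<Longrightarrow> \<bar>f s\<bar> \<le> B * norm s"
  obtains z where "z \<in> S" and "\<And>s. s \<in> S \<Longrightarrow> f s = s \<bullet> z"
proof -
  define q where "q s = s \<bullet> s - 2 * f s" for s
  have q_lower: "- B\<^sup>2 \<le> q s" if "s \<in> S" for s
  proof -
    have "f s \<le> norm s * B" using bound[OF that] by (simp add: mult.commute)
    then show ?thesis
      using zero_le_power2[of "norm s - B"] unfolding q_def power2_diff power2_norm_eq_inner
      by linarith
  qed
  have bdd: "bdd_below (q ` S)"
    using q_lower by (rule bdd_belowI2)
  define m where "m = Inf (q ` S)"
  have m_le: "m \<le> q s" if "s \<in> S" for s
    unfolding m_def using bdd that by (auto intro: cInf_lower)
  have "\<exists>s. s \<in> S \<and> q s < m + 1 / real (Suc n)" for n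
  proof -
    have "q ` S \<noteq> {}" using subspace_0[OF S] by auto
    moreover have "Inf (q ` S) < m + 1 / real (Suc n)" by (simp add: m_def)
    ultimately have "\<exists>y\<in>q ` S. y < m + 1 / real (Suc n)" by (rule cInf_lessD)
    then show ?thesis by blast
  qed
  then obtain s where sS: "\<And>n. s n \<in> S" and s_less: "\<And>n. q (s n) < m + 1 / real (Suc n)"
    by metis
  have lim_inv: "(\<lambda>n. m + 1 / real (Suc n)) \<longlonglongrightarrow> m"
    using tendsto_add[OF tendsto_const LIMSEQ_inverse_real_of_nat] by (simp add: inverse_eq_divide)
  have q_lim: "(\<lambda>n. q (s n)) \<longlonglongrightarrow> m"
    by (rule tendsto_sandwich[OF _ _ tendsto_const lim_inv])
      (intro always_eventually allI m_le sS less_imp_le[OF s_less])+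
  \<comment> \<open>The linear parts cancel in
    \<open>2 * q x + 2 * q y - 4 * q ((1/2) *\<^sub>R (x + y))\<close>, which leaves exactly the
    squared distance, and the midpoint lies in \<open>S\<close>. Hence a minimising sequence is
    Cauchy.\<close>
  have parallelogram: "(norm (x - y))\<^sup>2 \<le> 2 * q x + 2 * q y - 4 * m"
    if "x \<in> S" "y \<in> S" for x y
  proof -
    have xy: "x + y \<in> S" by (rule subspace_add[OF S that])
    have "m \<le> q ((1/2) *\<^sub>R (x + y))" by (rule m_le[OF subspace_scale[OF S xy]])
    then show ?thesis
      unfolding q_def scale[OF xy] add[OF that] power2_norm_eq_inner inner_scaleR_left
        inner_scaleR_right inner_diff_left inner_diff_right inner_add_left inner_add_right
        inner_commute[of y x]
      by (simp add: field_simps)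
  qed
  have "Cauchy s"
  proof (rule metric_CauchyI)
    fix e :: real assume "0 < e"
    then have "0 < e\<^sup>2 / 4" by simp
    then have "\<forall>\<^sub>F n in sequentially. q (s n) < m + e\<^sup>2 / 4"
      by (intro order_tendstoD(2)[OF q_lim]) simp
    then obtain n0 where n0: "\<And>n. n \<ge> n0 \<Longrightarrow> q (s n) < m + e\<^sup>2 / 4"
      unfolding eventually_sequentially by blast
    have "(norm (s i - s j))\<^sup>2 < e\<^sup>2" if "i \<ge> n0" "j \<ge> n0" for i j
      using parallelogram[OF sS sS, of i j] n0[OF that(1)] n0[OF that(2)] by linarith
    then have "dist (s i) (s j) < e" if "i \<ge> n0" "j \<ge> n0" for i j
      using that \<open>0 < e\<close> power2_less_imp_less[of "norm (s i - s j)" e] by (simp add: dist_norm)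
    then show "\<exists>M. \<forall>i\<ge>M. \<forall>j\<ge>M. dist (s i) (s j) < e" by blast
  qed
  then obtain z where s_lim: "s \<longlonglongrightarrow> z"
    using Cauchy_convergent convergent_def by blast
  have "z \<in> S"
    using closed_sequentially[OF \<open>closed S\<close>] sS s_lim by blast
  moreover have "f x = x \<bullet> z" if "x \<in> S" for x
  proof -
    define k where "k = x \<bullet> z - f x"
    \<comment> \<open>First variation in direction \<open>x\<close>. The perturbation
      \<open>t *\<^sub>R x\<close> is added to \<open>s n\<close> rather than to the limit
      \<open>z\<close>: \<open>q (s n)\<close> tends to \<open>m\<close> by construction, so
      \<open>q z\<close> never has to be evaluated.\<close>
    have variation: "0 \<le> 2 * t * k + t\<^sup>2 * (x \<bullet> x)" for t
    proof -
      have step: "\<forall>n. m \<le> q (s n) + 2 * t * (x \<bullet> s n - f x) + t\<^sup>2 * (x \<bullet> x)"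
      proof
        fix n
        have tx: "t *\<^sub>R x \<in> S" by (rule subspace_scale[OF S that])
        show "m \<le> q (s n) + 2 * t * (x \<bullet> s n - f x) + t\<^sup>2 * (x \<bullet> x)"
          using m_le[OF subspace_add[OF S sS tx], of n]
          unfolding q_def add[OF sS tx] scale[OF that]
          by (simp add: inner_add_left inner_add_right inner_commute power2_eq_square
              algebra_simps)
      qed
      have "(\<lambda>n. q (s n) + 2 * t * (x \<bullet> s n - f x) + t\<^sup>2 * (x \<bullet> x))
          \<longlonglongrightarrow> m + 2 * t * (x \<bullet> z - f x) + t\<^sup>2 * (x \<bullet> x)"
        by (intro tendsto_intros q_lim s_lim)
      from LIMSEQ_le_const[OF this] step
      have "m \<le> m + 2 * t * (x \<bullet> z - f x) + t\<^sup>2 * (x \<bullet> x)" by blast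
      then show ?thesis by (simp add: k_def)
    qed
    \<comment> \<open>At \<open>t = - r\<close> the quadratic equals
      \<open>- r\<^sup>2 * (x \<bullet> x + 2)\<close>, so its nonnegativity forces
      \<open>r = 0\<close>. The \<open>+ 1\<close> keeps the denominator positive when
      \<open>x = 0\<close>.\<close>
    define r where "r = k / (x \<bullet> x + 1)"
    have pos: "0 < x \<bullet> x + 1" by (simp add: add_nonneg_pos)
    then have k: "k = r * (x \<bullet> x + 1)" by (simp add: r_def)
    have "r\<^sup>2 * (x \<bullet> x + 2) = - (2 * (- r) * k + (- r)\<^sup>2 * (x \<bullet> x))"
      by (simp add: k power2_eq_square algebra_simps)
    then have "r\<^sup>2 * (x \<bullet> x + 2) \<le> 0" using variation[of "- r"] by simp
    then have "r\<^sup>2 \<le> 0" using pos by (simp add: mult_le_0_iff)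
    then have "k = 0" by (simp add: k)
    then show ?thesis by (simp add: k_def)
  qed
  ultimately show ?thesis using that by blast
qed

lemma orthogonal_projection_exists:
  fixes S :: "'a::{real_inner, complete_space} set"
  assumes "subspace S" "closed S"
  obtains z where "z \<in> S" and "\<And>s. s \<in> S \<Longrightarrow> s \<bullet> w = s \<bullet> z"
proof (rule riesz_on_closed_subspace[OF assms, of "\<lambda>s. s \<bullet> w" "norm w"])
  show "\<bar>s \<bullet> w\<bar> \<le> norm w * norm s" for s
    using Cauchy_Schwarz_ineq2[of s w] by (simp add: mult.commute)
qed (auto simp: inner_add_left intro: that)

text \<open>\<open>adjoint\<close> is a choice operator, so the identity rests on existence: for
  each \<open>y\<close> the functional \<open>\<lambda>x. H x \<bullet> y\<close> is bounded, and
  Riesz representation on the whole space supplies a vector.\<close>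

lemma adjoint_bounded_linear:
  fixes H :: "'h::{real_inner, complete_space} \<Rightarrow> 'y::real_inner"
  assumes "bounded_linear H"
  shows "H x \<bullet> y = x \<bullet> adjoint H y"
proof -
  interpret H: bounded_linear H by fact
  obtain K where K: "\<And>x. norm (H x) \<le> norm x * K" using H.bounded by blast
  have "\<exists>w. \<forall>x. H x \<bullet> y = x \<bullet> w" for y
  proof (rule riesz_on_closed_subspace[of UNIV "\<lambda>x. H x \<bullet> y" "K * norm y"])
    fix x
    have "\<bar>H x \<bullet> y\<bar> \<le> norm (H x) * norm y" by (rule Cauchy_Schwarz_ineq2)
    also have "\<dots> \<le> norm x * K * norm y" using K by (intro mult_right_mono) auto
    finally show "\<bar>H x \<bullet> y\<bar> \<le> K * norm y * norm x" by (simp add: mult_ac)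
  qed (auto simp: H.add H.scaleR inner_add_left)
  then have "\<exists>H'. \<forall>x y. H x \<bullet> y = x \<bullet> H' y" by metis
  then show ?thesis unfolding adjoint_def by (rule someI2_ex) simp
qed

lemma dense_inner_eq_imp_eq:
  fixes D :: "'h::real_inner set"
  assumes "closure D = UNIV" and "\<And>x. x \<in> D \<Longrightarrow> x \<bullet> v = x \<bullet> w"
  shows "v = w"
proof -
  have "closure D \<subseteq> {x. x \<bullet> v = x \<bullet> w}"
    using assms(2) by (intro closure_minimal closed_Collect_eq continuous_intros) auto
  then have "(v - w) \<bullet> v = (v - w) \<bullet> w" using assms(1) by auto
  then have "(v - w) \<bullet> (v - w) = 0" by (simp add: inner_diff_right)
  then show ?thesis by simp
qed

text \<open>Trades the definite description for an identity tested on \<open>D\<close>; density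
  makes the representing vector unique, so \<open>THE\<close> picks it.\<close>

lemma adjoint_on_eq_iff:
  fixes D :: "'h::real_inner set"
  assumes "closure D = UNIV"
  shows "z \<in> adjoint_domain D L \<and> adjoint_on D L z = w \<longleftrightarrow> (\<forall>x\<in>D. L x \<bullet> z = x \<bullet> w)"
proof -
  have eq: "adjoint_on D L z = v" if "\<forall>x\<in>D. L x \<bullet> z = x \<bullet> v" for v
    unfolding adjoint_on_def
    using that by (intro the_equality) (auto intro: dense_inner_eq_imp_eq[OF assms])
  then show ?thesis unfolding adjoint_domain_def by blast
qed

lemma linear_operator_onD:
  assumes "linear_operator_on D L"
  shows "subspace D"
    and "x \<in> D \<Longrightarrow> y \<in> D \<Longrightarrow> L (x + y) = L x + L y"
    and "x \<in> D \<Longrightarrow> L (r *\<^sub>R x) = r *\<^sub>R L x"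
  using assms by (auto simp: linear_operator_on_def)

lemma subspace_linear_operator_image:
  assumes "linear_operator_on D L"
  shows "subspace (L ` D)"
proof -
  note D = linear_operator_onD(1)[OF assms]
    and add = linear_operator_onD(2)[OF assms]
    and scale = linear_operator_onD(3)[OF assms]
  have "L 0 = 0" using scale[OF subspace_0[OF D], of 0] by simp
  then have "0 \<in> L ` D" using subspace_0[OF D] by (rule image_eqI[OF sym])
  moreover have "L x + L y \<in> L ` D" if "x \<in> D" "y \<in> D" for x y
    unfolding add[OF that, symmetric] by (rule imageI[OF subspace_add[OF D that]])
  moreover have "r *\<^sub>R L x \<in> L ` D" if "x \<in> D" for r x
    unfolding scale[OF that, symmetric] by (rule imageI[OF subspace_scale[OF D that]])
  ultimately show ?thesis by (auto intro!: subspaceI)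
qed

section \<open>The noise\<close>

text \<open>The zero mean removes the cross term of the square, and Cauchy-Schwarz with the variance
  bound limits the second moment of \<open>u \<bullet> \<eta>\<close>.\<close>

lemma noise_upper_bound:
  fixes u :: "'y::real_inner"
  assumes "(P, \<eta>) \<in> bounded_variance_noise"
  shows "(\<integral>\<^sup>+ w. ennreal ((a - u \<bullet> \<eta> w)\<^sup>2) \<partial>P) \<le> ennreal (a\<^sup>2 + (norm u)\<^sup>2)"
proof -
  define X where "X w = u \<bullet> \<eta> w" for w
  from assms have "prob_space P" and [measurable]: "\<eta> \<in> borel_measurable P"
    and bochner: "has_bochner_integral P X 0"
    and var: "(\<integral>\<^sup>+ w. ennreal (\<eta> w \<bullet> \<eta> w) \<partial>P) \<le> 1"
    by (auto simp: bounded_variance_noise_def zero_mean_random_vector_def X_def[abs_def])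
  interpret prob_space P by fact
  have X: "integrable P X" "integral\<^sup>L P X = 0"
    using bochner by (auto simp: has_bochner_integral_iff)
  then have [measurable]: "X \<in> borel_measurable P" by auto
  have "(\<integral>\<^sup>+ w. ennreal ((X w)\<^sup>2) \<partial>P)
      \<le> (\<integral>\<^sup>+ w. ennreal ((norm u)\<^sup>2) * ennreal ((norm (\<eta> w))\<^sup>2) \<partial>P)"
  proof (rule nn_integral_mono)
    fix w
    have "(X w)\<^sup>2 \<le> (norm u * norm (\<eta> w))\<^sup>2"
      unfolding X_def by (rule power2_le_iff_abs_le[THEN iffD2]) (auto intro: Cauchy_Schwarz_ineq2)
    then show "ennreal ((X w)\<^sup>2) \<le> ennreal ((norm u)\<^sup>2) * ennreal ((norm (\<eta> w))\<^sup>2)"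
      by (simp add: ennreal_mult[symmetric] ennreal_leI power_mult_distrib)
  qed
  also have "\<dots> = ennreal ((norm u)\<^sup>2) * (\<integral>\<^sup>+ w. ennreal ((norm (\<eta> w))\<^sup>2) \<partial>P)"
    by (rule nn_integral_cmult) measurable
  also have "\<dots> \<le> ennreal ((norm u)\<^sup>2) * 1"
    using var by (intro mult_left_mono) (auto simp: power2_norm_eq_inner)
  finally have second_moment: "(\<integral>\<^sup>+ w. ennreal ((X w)\<^sup>2) \<partial>P) \<le> ennreal ((norm u)\<^sup>2)" by simp
  \<comment> \<open>Finiteness of the second moment gives integrability, which permits expanding the
    square under the Bochner integral.\<close>
  then have "(\<integral>\<^sup>+ w. ennreal ((X w)\<^sup>2) \<partial>P) < \<infinity>"
    using ennreal_less_top le_less_trans by fastforce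
  then have X2: "integrable P (\<lambda>w. (X w)\<^sup>2)"
    by (intro integrableI_nonneg) auto
  have "ennreal (\<integral>w. (X w)\<^sup>2 \<partial>P) \<le> ennreal ((norm u)\<^sup>2)"
    using second_moment nn_integral_eq_integral[OF X2] by simp
  then have X2_le: "(\<integral>w. (X w)\<^sup>2 \<partial>P) \<le> (norm u)\<^sup>2" by (simp add: ennreal_le_iff)
  have expand: "(a - X w)\<^sup>2 = a\<^sup>2 - 2 * a * X w + (X w)\<^sup>2" for w
    by (simp add: power2_diff)
  have "integrable P (\<lambda>w. (a - X w)\<^sup>2)"
    unfolding expand using X X2 by simp
  then have "(\<integral>\<^sup>+ w. ennreal ((a - X w)\<^sup>2) \<partial>P) = ennreal (\<integral>w. (a - X w)\<^sup>2 \<partial>P)"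
    by (rule nn_integral_eq_integral) simp
  also have "(\<integral>w. (a - X w)\<^sup>2 \<partial>P) = a\<^sup>2 + (\<integral>w. (X w)\<^sup>2 \<partial>P)"
    unfolding expand using X X2 by (simp add: prob_space)
  finally show ?thesis using X2_le by (simp add: X_def ennreal_leI)
qed

lemma worst_noise:
  fixes u :: "'y::real_inner"
  obtains P \<eta> where "(P, \<eta>) \<in> bounded_variance_noise"
    and "\<And>a. (\<integral>\<^sup>+ w. ennreal ((a - u \<bullet> \<eta> w)\<^sup>2) \<partial>P) = ennreal (a\<^sup>2 + (norm u)\<^sup>2)"
proof -
  \<comment> \<open>This is the unit vector along \<open>u\<close>, or 0 if \<open>u = 0\<close>; in
    that case the noise vanishes and the claimed value is just \<open>a\<^sup>2\<close>.\<close>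
  define e where "e = sgn u"
  have ue: "u \<bullet> e = norm u"
    by (cases "u = 0") (simp_all add: e_def sgn_div_norm dot_square_norm power2_eq_square)
  have "e \<bullet> e \<le> 1" by (simp add: e_def dot_square_norm norm_sgn)
  define p where "p = map_pmf (\<lambda>b. if b then e else - e) (bernoulli_pmf (1/2))"
  have "has_bochner_integral (measure_pmf p) (\<lambda>w. v \<bullet> w) 0" for v
    by (simp add: has_bochner_integral_iff p_def integrable_map_pmf_eq
        integrable_measure_pmf_finite)
  moreover have "(\<integral>\<^sup>+ w. ennreal (w \<bullet> w) \<partial>measure_pmf p) \<le> 1"
  proof -
    have "(\<integral>\<^sup>+ w. ennreal (w \<bullet> w) \<partial>measure_pmf p) \<le> (\<integral>\<^sup>+ w. 1 \<partial>measure_pmf p)"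
      using \<open>e \<bullet> e \<le> 1\<close> by (intro nn_integral_mono_AE) (auto simp: AE_measure_pmf_iff p_def)
    then show ?thesis by (simp add: measure_pmf.emeasure_space_1[unfolded space_measure_pmf])
  qed
  ultimately have "(measure_pmf p, \<lambda>w. w) \<in> bounded_variance_noise"
    by (simp add: bounded_variance_noise_def zero_mean_random_vector_def
        measure_pmf.prob_space_axioms)
  moreover have "(\<integral>\<^sup>+ w. ennreal ((a - u \<bullet> w)\<^sup>2) \<partial>measure_pmf p) = ennreal (a\<^sup>2 + (norm u)\<^sup>2)" for a
  proof -
    have "(a - norm u)\<^sup>2 * (1/2) + (a + norm u)\<^sup>2 * (1/2) = a\<^sup>2 + (norm u)\<^sup>2"
      by (simp add: power2_eq_square field_simps)
    then have "(\<integral>w. (a - u \<bullet> w)\<^sup>2 \<partial>measure_pmf p) = a\<^sup>2 + (norm u)\<^sup>2"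
      by (simp add: p_def ue)
    moreover have "integrable (measure_pmf p) (\<lambda>w. (a - u \<bullet> w)\<^sup>2)"
      by (rule integrable_measure_pmf_finite) (simp add: p_def)
    ultimately show ?thesis by (simp add: nn_integral_eq_integral del: ennreal_plus)
  qed
  ultimately show ?thesis by (rule that)
qed

section \<open>The risk\<close>

text \<open>Removes probability from the problem. The error at \<open>x\<close> is a deterministic
  offset minus \<open>u \<bullet> \<eta>\<close>, and one and the same noise is worst for every
  offset.\<close>

lemma risk_bounded_variance_noise:
  "risk D L H G bounded_variance_noise l u c =
     (SUP x\<in>{x\<in>D. L x \<in> G}. ennreal ((l \<bullet> x - u \<bullet> H x - c)\<^sup>2 + (norm u)\<^sup>2))"
proof -
  obtain P \<eta> where noise: "(P, \<eta>) \<in> bounded_variance_noise"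
    and worst: "\<And>a. (\<integral>\<^sup>+ w. ennreal ((a - u \<bullet> \<eta> w)\<^sup>2) \<partial>P) = ennreal (a\<^sup>2 + (norm u)\<^sup>2)"
    using worst_noise[of u] by metis
  have "(SUP (P, \<eta>)\<in>bounded_variance_noise.
          \<integral>\<^sup>+ w. ennreal ((l \<bullet> x - u \<bullet> (H x + \<eta> w) - c)\<^sup>2) \<partial>P)
      = ennreal ((l \<bullet> x - u \<bullet> H x - c)\<^sup>2 + (norm u)\<^sup>2)" for x
  proof -
    have shift: "l \<bullet> x - u \<bullet> (H x + y) - c = (l \<bullet> x - u \<bullet> H x - c) - u \<bullet> y" for y
      by (simp add: inner_add_right)
    show ?thesis
      unfolding shift
    proof (rule antisym)
      show "(SUP (P, \<eta>)\<in>bounded_variance_noise.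
          \<integral>\<^sup>+ w. ennreal ((l \<bullet> x - u \<bullet> H x - c - u \<bullet> \<eta> w)\<^sup>2) \<partial>P)
        \<le> ennreal ((l \<bullet> x - u \<bullet> H x - c)\<^sup>2 + (norm u)\<^sup>2)"
        by (rule SUP_least) (auto simp del: ennreal_plus intro: noise_upper_bound)
      show "ennreal ((l \<bullet> x - u \<bullet> H x - c)\<^sup>2 + (norm u)\<^sup>2) \<le>
        (SUP (P, \<eta>)\<in>bounded_variance_noise.
          \<integral>\<^sup>+ w. ennreal ((l \<bullet> x - u \<bullet> H x - c - u \<bullet> \<eta> w)\<^sup>2) \<partial>P)"
        by (rule SUP_upper2[OF noise]) (simp add: worst)
    qed
  qed
  then show ?thesis by (simp add: risk_def)
qed

abbreviation unit_ball_risk ::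
  "'h::real_inner set \<Rightarrow> ('h \<Rightarrow> 'f::real_inner) \<Rightarrow> ('h \<Rightarrow> 'y::real_inner) \<Rightarrow>
     'h \<Rightarrow> 'y \<Rightarrow> real \<Rightarrow> ennreal"
  where "unit_ball_risk D L H \<equiv> risk D L H {f. f \<bullet> f \<le> 1} bounded_variance_noise"

section \<open>Weak form and solvability of the normal equations\<close>

lemma normal_equations_iff:
  fixes D :: "'h::{real_inner, complete_space} set" and H :: "'h \<Rightarrow> 'y::real_inner"
  assumes dense: "closure D = UNIV" and bounded_linear_H: "bounded_linear H"
  shows "normal_equations D L H l p z \<longleftrightarrow>
     p \<in> D \<and> z = L p \<and> (\<forall>x\<in>D. L x \<bullet> L p + H x \<bullet> H p = x \<bullet> l)"
  using adjoint_on_eq_iff[OF dense, of z L "l - adjoint H (H p)"]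
    adjoint_bounded_linear[OF bounded_linear_H, of _ "H p"]
  unfolding normal_equations_def by (auto simp: inner_diff_right algebra_simps)

text \<open>Estimability means that \<open>x \<bullet> l\<close> on \<open>D\<close> is the pairing
  of \<open>(L x, H x)\<close> with a fixed vector \<open>(z, u)\<close>. The normal equations ask
  in addition that this vector be \<open>(L p, H p)\<close>, a point of the range of
  \<open>T\<close>.\<close>

lemma estimable_iff:
  fixes D :: "'h::{real_inner, complete_space} set" and H :: "'h \<Rightarrow> 'y::real_inner"
  assumes dense: "closure D = UNIV" and bounded_linear_H: "bounded_linear H"
  shows "l \<in> estimable D L H \<longleftrightarrow> (\<exists>z u. \<forall>x\<in>D. L x \<bullet> z + H x \<bullet> u = x \<bullet> l)"
proof -
  have "l \<in> estimable D L H \<longleftrightarrow>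
      (\<exists>z u. z \<in> adjoint_domain D L \<and> adjoint_on D L z = l - adjoint H u)"
    unfolding estimable_def by (fastforce simp: eq_diff_eq)
  also have "\<dots> \<longleftrightarrow> (\<exists>z u. \<forall>x\<in>D. L x \<bullet> z + H x \<bullet> u = x \<bullet> l)"
    unfolding adjoint_on_eq_iff[OF dense]
    unfolding adjoint_bounded_linear[OF bounded_linear_H] inner_diff_right eq_diff_eq ..
  finally show ?thesis .
qed

lemma normal_equations_solvable:
  fixes D :: "'h::{real_inner, complete_space} set"
    and L :: "'h \<Rightarrow> 'f::{real_inner, complete_space}"
    and H :: "'h \<Rightarrow> 'y::{real_inner, complete_space}"
  assumes linear: "linear_operator_on D L" and dense: "closure D = UNIV"
    and bounded_linear_H: "bounded_linear H"
    and closed: "closed ((\<lambda>x. (L x, H x)) ` D)" and "l \<in> estimable D L H"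
  shows "\<exists>p z. normal_equations D L H l p z"
proof -
  let ?T = "\<lambda>x. (L x, H x)"
  obtain z u where zu: "\<And>x. x \<in> D \<Longrightarrow> L x \<bullet> z + H x \<bullet> u = x \<bullet> l"
    using estimable_iff[OF dense bounded_linear_H, THEN iffD1, OF assms(5)] by metis
  have "linear_operator_on D ?T"
    by (simp add: linear_operator_on_def linear_operator_onD[OF linear]
        linear_simps[OF bounded_linear_H])
  then have "subspace (?T ` D)" by (rule subspace_linear_operator_image)
  then obtain w where "w \<in> ?T ` D" and w: "\<And>s. s \<in> ?T ` D \<Longrightarrow> s \<bullet> (z, u) = s \<bullet> w"
    using orthogonal_projection_exists[OF _ closed] by metis
  then obtain p where p: "p \<in> D" "w = ?T p" by blast
  \<comment> \<open>Projecting \<open>(z, u)\<close> onto the range of \<open>?T\<close> leaves its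
    pairings with that range unchanged, so \<open>?T p\<close> represents \<open>l\<close> as
    well.\<close>
  have "L x \<bullet> L p + H x \<bullet> H p = x \<bullet> l" if "x \<in> D" for x
    using w[of "?T x"] that zu[OF that] p by simp
  then show ?thesis using p by (auto simp: normal_equations_iff[OF dense bounded_linear_H])
qed

lemma estimable_if_finite_risk:
  fixes D :: "'h::{real_inner, complete_space} set"
    and L :: "'h \<Rightarrow> 'f::{real_inner, complete_space}"
    and H :: "'h \<Rightarrow> 'y::real_inner"
  assumes linear: "linear_operator_on D L" and dense: "closure D = UNIV"
    and bounded_linear_H: "bounded_linear H"
    and closed: "closed (L ` D)" and finite: "unit_ball_risk D L H l u c < \<infinity>"
  shows "l \<in> estimable D L H"
proof -
  note D = linear_operator_onD(1)[OF linear]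
    and L_add = linear_operator_onD(2)[OF linear]
    and L_scale = linear_operator_onD(3)[OF linear]
  define g where "g x = l \<bullet> x - u \<bullet> H x" for x
  have g_add: "g (x + y) = g x + g y" and g_scale: "g (r *\<^sub>R x) = r * g x" for x y r
    by (simp_all add: g_def linear_simps[OF bounded_linear_H] inner_add_right algebra_simps)
  obtain r where "0 \<le> r" and r: "unit_ball_risk D L H l u c = ennreal r"
    using finite by (cases "unit_ball_risk D L H l u c") auto
  \<comment> \<open>The risk bounds \<open>\<bar>g x - c\<bar>\<close> by \<open>sqrt r\<close>; the
    second summand pays for removing \<open>c\<close>.\<close>
  define B where "B = sqrt r + \<bar>c\<bar>"
  have unit_bound: "\<bar>g x\<bar> \<le> B" if "x \<in> D" "norm (L x) \<le> 1" for x
  proof -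
    have "L x \<bullet> L x \<le> 1" using that by (simp add: dot_square_norm power_le_one)
    then have "ennreal ((g x - c)\<^sup>2 + (norm u)\<^sup>2) \<le> ennreal r"
      using that unfolding r[symmetric] risk_bounded_variance_noise g_def
      by (intro SUP_upper) auto
    then have "(g x - c)\<^sup>2 + (norm u)\<^sup>2 \<le> r" using ennreal_le_iff[OF \<open>0 \<le> r\<close>] by blast
    then have "(g x - c)\<^sup>2 \<le> r" using zero_le_power2[of "norm u"] by linarith
    then have "\<bar>g x - c\<bar> \<le> sqrt r" by (simp add: real_le_rsqrt)
    then show ?thesis unfolding B_def by linarith
  qed
  have "0 \<le> B" using \<open>0 \<le> r\<close> by (simp add: B_def)
  have bound: "\<bar>g x\<bar> \<le> B * norm (L x)" if "x \<in> D" for x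
  proof (cases "L x = 0")
    case True
    \<comment> \<open>On the kernel of \<open>L\<close> every multiple of \<open>x\<close> satisfies
      the constraint. Unless \<open>g x = 0\<close>, the value
      \<open>t = (B + 1) / \<bar>g x\<bar>\<close> chosen below would give
      \<open>B + 1 \<le> B\<close>.\<close>
    have "\<bar>g x\<bar> * t \<le> B" if "0 \<le> t" for t
    proof -
      have "\<bar>g (t *\<^sub>R x)\<bar> \<le> B"
        using \<open>x \<in> D\<close> True by (intro unit_bound) (auto simp: L_scale subspace_scale[OF D])
      then show ?thesis using that by (simp add: g_scale abs_mult mult.commute)
    qed
    from this[of "(B + 1) / \<bar>g x\<bar>"] \<open>0 \<le> B\<close> have "g x = 0" by (auto split: if_splits)
    then show ?thesis using True by simp
  next
    case False
    have "\<bar>g (inverse (norm (L x)) *\<^sub>R x)\<bar> \<le> B"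
      using that False by (intro unit_bound) (auto simp: L_scale subspace_scale[OF D])
    then show ?thesis using False by (simp add: g_scale abs_mult field_simps)
  qed
  \<comment> \<open>\<open>g\<close> descends to the range of \<open>L\<close>: by
    \<open>bound\<close> it vanishes on the kernel, so the choice of preimage does not
    matter.\<close>
  define f where "f s = g (inv_into D L s)" for s
  have f: "f (L x) = g x" if "x \<in> D" for x
  proof -
    let ?y = "inv_into D L (L x)"
    have y: "?y \<in> D" "L ?y = L x" using that by (auto intro: inv_into_into f_inv_into_f)
    have neg: "(-1) *\<^sub>R x \<in> D" by (rule subspace_scale[OF D that])
    have "L (?y + (-1) *\<^sub>R x) = 0" using y that neg by (simp only: L_add L_scale) simp
    with bound[OF subspace_add[OF D y(1) neg]] have "g (?y + (-1) *\<^sub>R x) = 0" by simp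
    then show ?thesis unfolding f_def by (simp only: g_add g_scale)
  qed
  obtain z where z: "\<And>s. s \<in> L ` D \<Longrightarrow> f s = s \<bullet> z"
  proof (rule riesz_on_closed_subspace[OF subspace_linear_operator_image[OF linear] closed,
        of f B])
    show "f (s + t) = f s + f t" if "s \<in> L ` D" "t \<in> L ` D" for s t
      using that subspace_add[OF D] by (auto simp: f g_add L_add[symmetric])
    show "f (r *\<^sub>R s) = r * f s" if "s \<in> L ` D" for r s
      using that subspace_scale[OF D] by (auto simp: f g_scale L_scale[symmetric])
    show "\<bar>f s\<bar> \<le> B * norm s" if "s \<in> L ` D" for s
      using that bound by (auto simp: f)
  qed auto
  have "L x \<bullet> z + H x \<bullet> u = x \<bullet> l" if "x \<in> D" for x
    using z[of "L x"] f[OF that] that by (simp add: g_def inner_commute)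
  then show ?thesis by (auto simp: estimable_iff[OF dense bounded_linear_H])
qed

section \<open>Upper and lower bounds on the risk\<close>

lemma normal_equationsD:
  fixes D :: "'h::{real_inner, complete_space} set" and H :: "'h \<Rightarrow> 'y::real_inner"
  assumes "closure D = UNIV" and "bounded_linear H" and "normal_equations D L H l p z"
  shows "p \<in> D" and "x \<in> D \<Longrightarrow> L x \<bullet> L p + H x \<bullet> H p = x \<bullet> l"
    and "l \<bullet> p = (norm (L p))\<^sup>2 + (norm (H p))\<^sup>2"
proof -
  have *: "p \<in> D" "\<forall>x\<in>D. L x \<bullet> L p + H x \<bullet> H p = x \<bullet> l"
    using assms(3) by (auto simp: normal_equations_iff[OF assms(1,2)])
  then show "p \<in> D" and "x \<in> D \<Longrightarrow> L x \<bullet> L p + H x \<bullet> H p = x \<bullet> l" by auto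
  \<comment> \<open>Testing at \<open>p\<close> itself shows that \<open>l \<bullet> p\<close> is a
    sum of squares, so neither \<open>ennreal\<close> nor the square root distorts it later.\<close>
  from * have "L p \<bullet> L p + H p \<bullet> H p = p \<bullet> l" by blast
  then show "l \<bullet> p = (norm (L p))\<^sup>2 + (norm (H p))\<^sup>2"
    unfolding power2_norm_eq_inner inner_commute[of l p] by (rule sym)
qed

text \<open>For \<open>u = H p\<close> the weak form reduces the offset to
  \<open>L x \<bullet> L p\<close>, at most \<open>norm (L p)\<close> in absolute value on the unit
  ball; adding the noise term \<open>(norm (H p))\<^sup>2\<close> gives
  \<open>l \<bullet> p\<close>.\<close>

lemma risk_upper:
  fixes D :: "'h::{real_inner, complete_space} set" and L :: "'h \<Rightarrow> 'f::real_inner"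
    and H :: "'h \<Rightarrow> 'y::real_inner"
  assumes dense: "closure D = UNIV" and bounded_linear_H: "bounded_linear H"
    and normal: "normal_equations D L H l p z"
  shows "unit_ball_risk D L H l (H p) 0 \<le> ennreal (l \<bullet> p)"
  unfolding risk_bounded_variance_noise
proof (rule SUP_least)
  fix x assume x: "x \<in> {x \<in> D. L x \<in> {f. f \<bullet> f \<le> 1}}"
  then have "l \<bullet> x - H p \<bullet> H x = L x \<bullet> L p"
    using normal_equationsD(2)[OF dense bounded_linear_H normal, of x] inner_commute[of l x] inner_commute[of "H p" "H x"] by simp
  moreover have "(L x \<bullet> L p)\<^sup>2 \<le> (L x \<bullet> L x) * (L p \<bullet> L p)" by (rule Cauchy_Schwarz_ineq)
  moreover have "\<dots> \<le> 1 * (L p \<bullet> L p)" using x by (intro mult_right_mono) auto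
  ultimately show "ennreal ((l \<bullet> x - H p \<bullet> H x - 0)\<^sup>2 + (norm (H p))\<^sup>2) \<le> ennreal (l \<bullet> p)"
    by (intro ennreal_leI) (simp add: normal_equationsD(3)[OF dense bounded_linear_H normal] power2_norm_eq_inner)
qed

text \<open>The excess \<open>(norm (H p - u))\<^sup>2\<close> serves twice: dropping it gives
  minimality of \<open>H p\<close>, keeping it gives uniqueness. Multiples of \<open>p\<close>
  suffice as test vectors.\<close>

lemma risk_lower:
  fixes D :: "'h::{real_inner, complete_space} set" and L :: "'h \<Rightarrow> 'f::real_inner"
    and H :: "'h \<Rightarrow> 'y::real_inner"
  assumes linear: "linear_operator_on D L" and dense: "closure D = UNIV"
    and bounded_linear_H: "bounded_linear H" and normal: "normal_equations D L H l p z"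
  shows "ennreal (l \<bullet> p + (norm (H p - u))\<^sup>2) \<le> unit_ball_risk D L H l u c"
proof -
  note D = linear_operator_onD(1)[OF linear]
    and L_scale = linear_operator_onD(3)[OF linear]
  note p_in_D = normal_equationsD(1)[OF dense bounded_linear_H normal]
    and l_inner_p = normal_equationsD(3)[OF dense bounded_linear_H normal]
  \<comment> \<open>In these terms \<open>l \<bullet> p - u \<bullet> H p = a\<^sup>2 + d\<close>,
    the offset at \<open>p\<close> before subtracting \<open>c\<close>.\<close>
  define a d where "a = norm (L p)" and "d = H p \<bullet> (H p - u)"
  have test: "ennreal (t\<^sup>2 * (a\<^sup>2 + d)\<^sup>2 + (norm u)\<^sup>2) \<le> unit_ball_risk D L H l u c" if t: "\<bar>t\<bar> * a \<le> 1" for t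
  proof -
    text \<open>The test vectors \<open>t p\<close> and \<open>- t p\<close> together remove the influence of \<open>c\<close>.\<close>
    have *: "ennreal ((s * (a\<^sup>2 + d) - c)\<^sup>2 + (norm u)\<^sup>2) \<le> unit_ball_risk D L H l u c" if "\<bar>s\<bar> = \<bar>t\<bar>" for s
    proof -
      have "norm (L (s *\<^sub>R p)) \<le> 1" using t that p_in_D by (simp add: L_scale a_def)
      then have "L (s *\<^sub>R p) \<bullet> L (s *\<^sub>R p) \<le> 1" by (simp add: dot_square_norm power_le_one)
      moreover have "l \<bullet> (s *\<^sub>R p) - u \<bullet> H (s *\<^sub>R p) = s * (a\<^sup>2 + d)"
        by (simp add: linear_simps(5)[OF bounded_linear_H] l_inner_p a_def d_def inner_diff_right power2_norm_eq_inner
            inner_commute algebra_simps)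
      ultimately show ?thesis
        unfolding risk_bounded_variance_noise using p_in_D
        by (intro SUP_upper2[of "s *\<^sub>R p"]) (auto simp: subspace_scale[OF D])
    qed
    have "(t * (a\<^sup>2 + d))\<^sup>2 \<le> (t * (a\<^sup>2 + d) - c)\<^sup>2 \<or> (t * (a\<^sup>2 + d))\<^sup>2 \<le> (- t * (a\<^sup>2 + d) - c)\<^sup>2"
    proof (cases "t * (a\<^sup>2 + d) * c \<le> 0")
      case True
      then have "(t * (a\<^sup>2 + d))\<^sup>2 \<le> (t * (a\<^sup>2 + d) - c)\<^sup>2"
        unfolding power2_diff using zero_le_power2[of c] by linarith
      then show ?thesis ..
    next
      case False
      have "(- t * (a\<^sup>2 + d) - c)\<^sup>2 = (t * (a\<^sup>2 + d))\<^sup>2 + 2 * (t * (a\<^sup>2 + d) * c) + c\<^sup>2"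
        by (simp add: power2_eq_square algebra_simps)
      with False show ?thesis using zero_le_power2[of c] by linarith
    qed
    then have "ennreal ((t * (a\<^sup>2 + d))\<^sup>2 + (norm u)\<^sup>2) \<le> unit_ball_risk D L H l u c"
      using order_trans[OF ennreal_leI *[of t]] order_trans[OF ennreal_leI *[of "- t"]]
      by (auto simp del: ennreal_plus)
    then show ?thesis by (simp add: power_mult_distrib)
  qed
  \<comment> \<open>With this expansion it remains to find \<open>t\<close> with
    \<open>\<bar>t\<bar> * a \<le> 1\<close> and
    \<open>a\<^sup>2 + 2 * d \<le> t\<^sup>2 * (a\<^sup>2 + d)\<^sup>2\<close>.\<close>
  have norm_u: "(norm u)\<^sup>2 = (norm (H p))\<^sup>2 - 2 * d + (norm (H p - u))\<^sup>2"
    by (simp add: d_def power2_norm_eq_inner inner_diff_left inner_diff_right inner_commute)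
  show ?thesis
  proof (cases "a = 0")
    case False
    then have "0 < a" by (simp add: a_def)
    \<comment> \<open>The largest admissible factor \<open>1 / a\<close> turns the right side into
      \<open>(a + d / a)\<^sup>2\<close>, with surplus \<open>(d / a)\<^sup>2\<close>.\<close>
    have "l \<bullet> p + (norm (H p - u))\<^sup>2 \<le> (1 / a)\<^sup>2 * (a\<^sup>2 + d)\<^sup>2 + (norm u)\<^sup>2"
    proof -
      have "(1 / a)\<^sup>2 * (a\<^sup>2 + d)\<^sup>2 = a\<^sup>2 + 2 * d + (d / a)\<^sup>2"
        using \<open>0 < a\<close> by (simp add: power2_eq_square field_simps)
      then show ?thesis
        using zero_le_power2[of "d / a"] by (simp add: norm_u l_inner_p a_def[symmetric])
    qed
    then show ?thesis
      using \<open>0 < a\<close> by (intro order_trans[OF ennreal_leI test[of "1 / a"]]) auto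
  next
    case True
    \<comment> \<open>Now every \<open>t\<close> is admissible and
      \<open>2 * d \<le> t\<^sup>2 * d\<^sup>2\<close> is wanted. The quotient makes
      \<open>t * d\<^sup>2\<close> exceed \<open>2 * \<bar>d\<bar>\<close>, and the
      \<open>+ 1\<close> ensures \<open>t \<le> t\<^sup>2\<close>; for \<open>d = 0\<close> both
      sides vanish.\<close>
    define t where "t = 2 * \<bar>d\<bar> / d\<^sup>2 + 1"
    have "2 * d \<le> t\<^sup>2 * d\<^sup>2"
    proof (cases "d = 0")
      case False
      have "1 \<le> t" by (simp add: t_def)
      then have "t \<le> t\<^sup>2" by (simp add: power2_eq_square)
      then have "t * d\<^sup>2 \<le> t\<^sup>2 * d\<^sup>2" by (intro mult_right_mono) auto
      moreover have "t * d\<^sup>2 = 2 * \<bar>d\<bar> + d\<^sup>2" using False by (simp add: t_def field_simps)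
      ultimately show ?thesis using zero_le_power2[of d] by linarith
    qed simp
    then have "l \<bullet> p + (norm (H p - u))\<^sup>2 \<le> t\<^sup>2 * (a\<^sup>2 + d)\<^sup>2 + (norm u)\<^sup>2"
      using True by (simp add: norm_u l_inner_p a_def[symmetric])
    then show ?thesis
      using True by (intro order_trans[OF ennreal_leI test[of t]]) auto
  qed
qed

section \<open>Minimax risk, error and estimation\<close>

lemma minimax_risk_eq:
  fixes D :: "'h::{real_inner, complete_space} set" and L :: "'h \<Rightarrow> 'f::real_inner"
    and H :: "'h \<Rightarrow> 'y::real_inner"
  assumes linear: "linear_operator_on D L" and dense: "closure D = UNIV"
    and bounded_linear_H: "bounded_linear H" and normal: "normal_equations D L H l p z"
  shows "minimax_risk D L H {f. f \<bullet> f \<le> 1} bounded_variance_noise l = ennreal (l \<bullet> p)"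
  unfolding minimax_risk_def
proof (rule antisym)
  show "(INF u. INF c. unit_ball_risk D L H l u c) \<le> ennreal (l \<bullet> p)"
    by (intro INF_lower2[of "H p"] INF_lower2[of 0] UNIV_I
        risk_upper[OF dense bounded_linear_H normal])
  have "ennreal (l \<bullet> p) \<le> unit_ball_risk D L H l u c" for u c
    using risk_lower[OF assms, of u c] by (rule order_trans[rotated]) (simp add: ennreal_leI)
  then show "ennreal (l \<bullet> p) \<le> (INF u. INF c. unit_ball_risk D L H l u c)"
    by (intro INF_greatest)
qed

lemma minimax_error_eq:
  fixes D :: "'h::{real_inner, complete_space} set" and L :: "'h \<Rightarrow> 'f::real_inner"
    and H :: "'h \<Rightarrow> 'y::real_inner"
  assumes linear: "linear_operator_on D L" and dense: "closure D = UNIV"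
    and bounded_linear_H: "bounded_linear H" and normal: "normal_equations D L H l p z"
  shows "minimax_error D L H {f. f \<bullet> f \<le> 1} bounded_variance_noise l = ereal (sqrt (l \<bullet> p))"
  unfolding minimax_error_def minimax_risk_eq[OF assms]
  by (simp add: normal_equationsD(3)[OF dense bounded_linear_H normal] del: ennreal_plus)

text \<open>A risk equal to the minimum leaves no room for the excess term of
  \<open>risk_lower\<close>, whatever \<open>c\<close> is. In particular \<open>H p\<close> is the
  same for all solutions \<open>p\<close>, although \<open>p\<close> itself may vary.\<close>

lemma minimax_estimation_iff:
  fixes D :: "'h::{real_inner, complete_space} set" and L :: "'h \<Rightarrow> 'f::real_inner"
    and H :: "'h \<Rightarrow> 'y::real_inner"
  assumes linear: "linear_operator_on D L" and dense: "closure D = UNIV"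
    and bounded_linear_H: "bounded_linear H" and normal: "normal_equations D L H l p z"
  shows "minimax_estimation D L H {f. f \<bullet> f \<le> 1} bounded_variance_noise l u \<longleftrightarrow> u = H p"
proof
  assume "minimax_estimation D L H {f. f \<bullet> f \<le> 1} bounded_variance_noise l u"
  then obtain c where "unit_ball_risk D L H l u c = ennreal (l \<bullet> p)"
    unfolding minimax_estimation_def minimax_risk_eq[OF assms] by blast
  with risk_lower[OF assms, of u c] have "(norm (H p - u))\<^sup>2 \<le> 0"
    by (simp add: ennreal_le_iff normal_equationsD(3)[OF dense bounded_linear_H normal])
  then show "u = H p" by simp
next
  assume "u = H p"
  moreover have "ennreal (l \<bullet> p) \<le> unit_ball_risk D L H l (H p) 0"
    using risk_lower[OF assms, of "H p" 0] by simp
  ultimately have "unit_ball_risk D L H l u 0 = ennreal (l \<bullet> p)"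
    using risk_upper[OF dense bounded_linear_H normal] by (simp add: antisym)
  then show "minimax_estimation D L H {f. f \<bullet> f \<le> 1} bounded_variance_noise l u"
    unfolding minimax_estimation_def minimax_risk_eq[OF assms] by (auto intro: exI[of _ 0])
qed

theorem corollary1:
  fixes D :: "'h::{real_inner, complete_space} set"
    and L :: "'h \<Rightarrow> 'f::{real_inner, complete_space}"
    and H :: "'h \<Rightarrow> 'y::{real_inner, complete_space}"
    and G :: "'f set"
    and N :: "'y noise set"
    and l :: 'h
  assumes "closed_densely_defined D L"
    and "bounded_linear H"
    and "G = {f. f \<bullet> f \<le> 1}"
    and "N = bounded_variance_noise"
    and "closed (L ` D)"
    and "closed (H ` kernel_on D L)"
    and "closed ((\<lambda>x. (L x, H x)) ` D)"
  shows
    "(l \<in> estimable D L H \<longrightarrow>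
        (\<exists>!u. minimax_estimation D L H G N l u) \<and>
        (\<exists>p z. normal_equations D L H l p z) \<and>
        (\<forall>p z. normal_equations D L H l p z \<longrightarrow>
           minimax_estimation D L H G N l (H p) \<and>
           minimax_error D L H G N l = ereal (sqrt (l \<bullet> p)))) \<and>
     (l \<notin> estimable D L H \<longrightarrow>
        minimax_error D L H G N l = \<infinity> \<and>
        \<not> (\<exists>u. minimax_estimation D L H G N l u))"
proof -
  have linear: "linear_operator_on D L" and dense: "closure D = UNIV"
    using assms(1) by (auto simp: closed_densely_defined_def)
  note estimation_iff = minimax_estimation_iff[OF linear dense assms(2)]
    and error_eq = minimax_error_eq[OF linear dense assms(2)]
  show ?thesis
  proof (intro conjI impI)
    assume "l \<in> estimable D L H"
    then obtain p z where "normal_equations D L H l p z"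
      using normal_equations_solvable[OF linear dense assms(2,7)] by blast
    then show "\<exists>!u. minimax_estimation D L H G N l u" and "\<exists>p z. normal_equations D L H l p z"
      unfolding assms(3,4) using estimation_iff by auto
  next
    show "\<forall>p z. normal_equations D L H l p z \<longrightarrow>
           minimax_estimation D L H G N l (H p) \<and>
           minimax_error D L H G N l = ereal (sqrt (l \<bullet> p))"
      unfolding assms(3,4) by (simp add: estimation_iff error_eq)
  next
    assume "l \<notin> estimable D L H"
    \<comment> \<open>A single finite value would make \<open>l\<close> estimable. With infinite
      risk everywhere, the finiteness clause of \<open>minimax_estimation\<close> excludes every
      \<open>u\<close>.\<close>
    then have "risk D L H G N l u c = \<infinity>" for u c
      using estimable_if_finite_risk[OF linear dense assms(2,5), of l u c]
      unfolding assms(3,4) by (auto simp: less_top[symmetric])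
    then have "minimax_risk D L H G N l = \<infinity>"
      by (simp add: minimax_risk_def)
    then show "minimax_error D L H G N l = \<infinity>"
      and "\<not> (\<exists>u. minimax_estimation D L H G N l u)"
      by (auto simp: minimax_error_def minimax_estimation_def)
  qed
qed

end
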